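(* Let $A\in\mathbb{Z}^{m\times n}$ with $m\ge n$ have full column rank, let $b\in\mathbb{R}^m$, and let $P=P(A,b)=\{x\in\mathbb{R}^n: Ax\le b\}$ be a polytope such that every row of $A$ defines a facet of $P$. If $\Delta(A)=1$, then $$w(P)=w^{\mathcal{F}}(P).$$
   Context: $\Delta(A)$ is the maximum absolute value of an $n\times n$ minor of $A$. The lattice width is $w(P)=\min_{z\in\mathbb{Z}^n\setminus\{0\}}\big(\max_{x\in P}z^Tx-\min_{y\in P}z^Ty\big)$. $\mathcal{F}$ is the set of facet normals of $P$, here the set of (transposed) rows of $A$, and the facet width is $w^{\mathcal{F}}(P)=\min_{z\in\mathcal{F}}\big(\max_{x\in P}z^Tx-\min_{y\in P}z^Ty\big)$. *)

theory Defs
  imports "HOL-Analysis.Analysis"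
begin

abbreviation real_mat :: "int ^ 'n ^ 'm \<Rightarrow> real ^ 'n ^ 'm" where
  "real_mat \<equiv> map_matrix real_of_int"

definition polyhedron_of :: "int ^ 'n ^ 'm \<Rightarrow> real ^ 'm \<Rightarrow> (real ^ 'n) set" where
  "polyhedron_of A b = {x. \<forall>i. (real_mat A *v x) $ i \<le> b $ i}"

(* A choice of CARD('n) distinct rows is an injection f of the column indices into the row
   indices.  The injections with a given range differ only by a permutation of the rows of the
   submatrix, which does not affect the absolute value of the minor.  The set is nonempty iff
   CARD('n) \<le> CARD('m). *)
definition max_minor :: "int ^ 'n ^ 'm \<Rightarrow> int" where
  "max_minor A = Max {\<bar>det (\<chi> i. A $ f i)\<bar> | f :: 'n \<Rightarrow> 'm. inj f}"

(* For a nonempty compact P the supremum and the infimum are attained. *)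
definition width_along :: "(real ^ 'n) set \<Rightarrow> real ^ 'n \<Rightarrow> real" where
  "width_along P z = (SUP x\<in>P. z \<bullet> x) - (INF y\<in>P. z \<bullet> y)"

definition int_vectors :: "(real ^ 'n) set" where
  "int_vectors = {z. \<forall>i. z $ i \<in> \<int>}"

(* The set of directions is infinite, hence INF; for a compact P with nonempty interior the
   infimum is a minimum, since only finitely many integer directions have width below any
   given bound. *)
definition lattice_width :: "(real ^ 'n) set \<Rightarrow> real" where
  "lattice_width P = (INF z\<in>int_vectors - {0}. width_along P z)"

(* N is the (finite, nonempty) set of facet normals of P. *)
definition facet_width :: "(real ^ 'n) set \<Rightarrow> (real ^ 'n) set \<Rightarrow> real" where
  "facet_width N P = Min (width_along P ` N)"

end

theory Submission
  imports Defs
begin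

text \<open>
  Write \<open>a\<^sub>i\<close> for the rows of \<open>A\<close>.  They are nonzero integer vectors (a zero row cannot define
  a facet), so the lattice width is at most the facet width.

  For the converse, take a nonzero integer direction \<open>z\<close> and a point \<open>v\<close> of \<open>P\<close> maximising \<open>z\<close>.
  By Farkas' lemma (\<open>maximizer_imp_in_tight_cone\<close>), \<open>z\<close> lies in the cone generated by the rows
  that are tight at \<open>v\<close>; by Caratheodory's theorem for cones
  (\<open>conic_caratheodory\<close>), \<open>z = (\<Sum>a\<in>T. c a *\<^sub>R a)\<close> with \<open>c \<ge> 0\<close> and \<open>T\<close> a linearly
  independent set of tight rows.  Unimodularity makes the coefficients integral
  (\<open>unimodular_coefficients_integral\<close>), and since \<open>z \<noteq> 0\<close> some \<open>c a\<close> is therefore at least 1.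
  Every row in \<open>T\<close> attains its maximum over \<open>P\<close> at \<open>v\<close>, so for each \<open>y \<in> P\<close> all summands of
  \<open>z \<bullet> v - z \<bullet> y = (\<Sum>a'\<in>T. c a' * (a' \<bullet> v - a' \<bullet> y))\<close> are nonnegative, whence
  \<open>z \<bullet> v - z \<bullet> y \<ge> a \<bullet> v - a \<bullet> y\<close>.  With \<open>y\<close> a minimiser of \<open>a\<close>, the right-hand side is the
  width of \<open>P\<close> along the row \<open>a\<close>.
\<close>

section \<open>Cones generated by finitely many vectors\<close>

lemma convex_cone_hull_finite_subset:
  fixes S :: "'a::real_vector set"
  assumes "finite S" "z \<in> convex_cone hull S"
  obtains c where "\<And>x. x \<in> S \<Longrightarrow> 0 \<le> c x" "z = (\<Sum>x\<in>S. c x *\<^sub>R x)"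
proof -
  define K where "K = {z. \<exists>c. (\<forall>x\<in>S. 0 \<le> c x) \<and> z = (\<Sum>x\<in>S. c x *\<^sub>R x)}"
  have "S \<subseteq> K"
  proof
    fix s assume "s \<in> S"
    have "(\<Sum>x\<in>S. (if x = s then 1 else 0) *\<^sub>R x) = (\<Sum>x\<in>S. if x = s then x else 0)"
      by (rule sum.cong) auto
    also have "\<dots> = s"
      using assms(1) \<open>s \<in> S\<close> by simp
    finally show "s \<in> K"
      unfolding K_def by (intro CollectI exI[of _ "\<lambda>x. if x = s then 1 else 0"]) auto
  qed
  moreover have "convex_cone K"
    unfolding convex_cone_iff
  proof (intro conjI ballI allI impI)
    show "0 \<in> K"
      unfolding K_def by (intro CollectI exI[of _ "\<lambda>x. 0"]) auto
  next
    fix x y assume "x \<in> K" "y \<in> K"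
    then obtain c d where "\<forall>x\<in>S. 0 \<le> c x" "x = (\<Sum>x\<in>S. c x *\<^sub>R x)"
      "\<forall>x\<in>S. 0 \<le> d x" "y = (\<Sum>x\<in>S. d x *\<^sub>R x)"
      unfolding K_def by auto
    then show "x + y \<in> K"
      unfolding K_def
      by (intro CollectI exI[of _ "\<lambda>x. c x + d x"]) (auto simp: scaleR_left_distrib sum.distrib)
  next
    fix x r assume "x \<in> K" "(0::real) \<le> r"
    then obtain c where "\<forall>x\<in>S. 0 \<le> c x" "x = (\<Sum>x\<in>S. c x *\<^sub>R x)"
      unfolding K_def by auto
    then show "r *\<^sub>R x \<in> K"
      unfolding K_def using \<open>0 \<le> r\<close>
      by (intro CollectI exI[of _ "\<lambda>x. r * c x"]) (auto simp: scaleR_sum_right)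
  qed
  ultimately have "convex_cone hull S \<subseteq> K"
    by (rule hull_minimal)
  then show ?thesis
    using assms(2) that unfolding K_def by auto
qed

text \<open>
  As long as the generators are dependent, subtracting a suitable multiple of a linear relation
  makes one coefficient vanish and keeps the others nonnegative, so a generator can be dropped.
\<close>

lemma conic_caratheodory:
  fixes S :: "'a::real_vector set"
  assumes "finite S" "\<And>x. x \<in> S \<Longrightarrow> 0 \<le> c x"
  obtains T d where "T \<subseteq> S" "independent T" "\<And>x. x \<in> T \<Longrightarrow> 0 \<le> d x"
    "(\<Sum>x\<in>S. c x *\<^sub>R x) = (\<Sum>x\<in>T. d x *\<^sub>R x)"
proof -
  have "\<exists>T d. T \<subseteq> S \<and> independent T \<and> (\<forall>x\<in>T. 0 \<le> d x) \<and>
      (\<Sum>x\<in>S. c x *\<^sub>R x) = (\<Sum>x\<in>T. d x *\<^sub>R x)"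
    using assms
  proof (induction S arbitrary: c rule: finite_psubset_induct)
    case (psubset S)
    show ?case
    proof (cases "independent S")
      case True
      then show ?thesis
        using psubset.prems by blast
    next
      case False
      then obtain u0 where u0: "\<exists>v\<in>S. u0 v \<noteq> 0" "(\<Sum>v\<in>S. u0 v *\<^sub>R v) = 0"
        using psubset.hyps dependent_finite by blast
      have "\<exists>u. (\<exists>v\<in>S. u v > 0) \<and> (\<Sum>v\<in>S. u v *\<^sub>R v) = (0::'a)"
      proof (cases "\<exists>v\<in>S. u0 v > 0")
        case False
        have "(\<Sum>v\<in>S. (- u0 v) *\<^sub>R v) = 0"
          using u0(2) by (simp add: sum_negf)
        moreover have "\<exists>v\<in>S. - u0 v > 0"
          using u0(1) False by (auto simp: neq_iff)
        ultimately show ?thesis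
          by (intro exI[of _ "\<lambda>v. - u0 v"]) simp
      qed (use u0 in blast)
      then obtain u where u: "\<exists>v\<in>S. u v > 0" "(\<Sum>v\<in>S. u v *\<^sub>R v) = 0"
        by blast
      define Q where "Q = {v\<in>S. u v > 0}"
      have Q: "finite Q" "Q \<noteq> {}"
        unfolding Q_def using psubset.hyps u(1) by auto
      \<comment> \<open>The largest multiple of the relation that keeps all coefficients nonnegative.\<close>
      define t where "t = Min ((\<lambda>v. c v / u v) ` Q)"
      have "t \<in> (\<lambda>v. c v / u v) ` Q"
        unfolding t_def using Q by (intro Min_in) auto
      then obtain x0 where x0: "x0 \<in> Q" "t = c x0 / u x0"
        by blast
      have t_le: "t \<le> c v / u v" if "v \<in> Q" for v
        unfolding t_def using that Q by (intro Min_le) auto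
      have "0 \<le> t"
        using x0 psubset.prems unfolding Q_def by auto
      have x0S: "x0 \<in> S" and ux0: "u x0 > 0"
        using x0 unfolding Q_def by auto
      define d where "d = (\<lambda>v. c v - t * u v)"
      have d_nonneg: "0 \<le> d v" if "v \<in> S" for v
      proof (cases "u v > 0")
        case True
        then show ?thesis
          using t_le[of v] that unfolding Q_def d_def by (simp add: field_simps)
      next
        case False
        then have "t * u v \<le> 0"
          using \<open>0 \<le> t\<close> by (simp add: mult_nonneg_nonpos)
        then show ?thesis
          using psubset.prems[OF that] unfolding d_def by simp
      qed
      have "d x0 = 0"
        unfolding d_def using x0(2) ux0 by simp
      have "(\<Sum>v\<in>S. d v *\<^sub>R v) = (\<Sum>v\<in>S. c v *\<^sub>R v) - t *\<^sub>R (\<Sum>v\<in>S. u v *\<^sub>R v)"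
        unfolding d_def by (simp add: scaleR_left_diff_distrib sum_subtractf scaleR_sum_right)
      then have "(\<Sum>v\<in>S. c v *\<^sub>R v) = (\<Sum>v\<in>S. d v *\<^sub>R v)"
        using u(2) by simp
      also have "\<dots> = (\<Sum>v\<in>S - {x0}. d v *\<^sub>R v)"
        using psubset.hyps x0S \<open>d x0 = 0\<close> by (simp add: sum.remove)
      finally have eq: "(\<Sum>v\<in>S. c v *\<^sub>R v) = (\<Sum>v\<in>S - {x0}. d v *\<^sub>R v)" .
      have "\<exists>T e. T \<subseteq> S - {x0} \<and> independent T \<and> (\<forall>x\<in>T. 0 \<le> e x) \<and>
          (\<Sum>x\<in>S - {x0}. d x *\<^sub>R x) = (\<Sum>x\<in>T. e x *\<^sub>R x)"
        using x0S d_nonneg by (intro psubset.IH) auto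
      then show ?thesis
        unfolding eq by blast
    qed
  qed
  then show ?thesis
    using that by blast
qed

section \<open>Optimality and tight constraints\<close>

lemma polyhedron_of_iff:
  "x \<in> polyhedron_of A b \<longleftrightarrow> (\<forall>i. row i (real_mat A) \<bullet> x \<le> b $ i)"
  by (simp add: polyhedron_of_def matrix_mult_dot row_def vec_lambda_eta del: nth_map_matrix)

text \<open>
  Otherwise a hyperplane separates \<open>z\<close> from the closed cone of tight rows, and a short step from
  \<open>v\<close> along its normal, towards the side of \<open>z\<close>, stays in the polyhedron and increases \<open>z\<close>.
\<close>

lemma maximizer_imp_in_tight_cone:
  fixes A :: "int ^ 'n ^ 'm"
  assumes v: "v \<in> polyhedron_of A b"
    and max: "\<And>x. x \<in> polyhedron_of A b \<Longrightarrow> z \<bullet> x \<le> z \<bullet> v"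
  shows "z \<in> convex_cone hull {row i (real_mat A) | i. row i (real_mat A) \<bullet> v = b $ i}"
    (is "z \<in> convex_cone hull ?S")
proof (rule ccontr)
  let ?a = "\<lambda>i. row i (real_mat A)"
  assume "z \<notin> convex_cone hull ?S"
  moreover have "closed (convex_cone hull ?S)"
    by (rule closed_convex_cone_hull) simp
  ultimately obtain d \<beta> where d: "d \<bullet> z < \<beta>" "\<And>x. x \<in> convex_cone hull ?S \<Longrightarrow> \<beta> < d \<bullet> x"
    using separating_hyperplane_closed_point[OF convex_convex_cone_hull] by blast
  have "\<beta> < 0"
    using d(2)[OF convex_cone_hull_contains_0] by simp
  have tight: "0 \<le> d \<bullet> x" if "x \<in> ?S" for x
  proof (rule ccontr)
    assume neg: "\<not> 0 \<le> d \<bullet> x"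
    \<comment> \<open>Scaled by this factor, \<open>x\<close> would land exactly on the separating hyperplane.\<close>
    have "(\<beta> / (d \<bullet> x)) *\<^sub>R x \<in> convex_cone hull ?S"
      using that neg \<open>\<beta> < 0\<close>
      by (intro convex_cone_hull_mul hull_inc) (auto simp: divide_nonpos_neg)
    from d(2)[OF this] show False
      using neg by simp
  qed
  \<comment> \<open>A step in direction \<open>- d\<close> does not increase tight constraints, and a short one
    keeps the slack constraints satisfied.\<close>
  have ev: "\<forall>\<^sub>F e in at_right 0. ?a i \<bullet> (v - e *\<^sub>R d) \<le> b $ i" for i
  proof (cases "?a i \<bullet> v = b $ i")
    case True
    then have "0 \<le> ?a i \<bullet> d"
      using tight[of "?a i"] by (auto simp: inner_commute)
    then show ?thesis
      using True by (auto simp: eventually_at_filter inner_diff_right intro!: always_eventually)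
  next
    case False
    then have less: "?a i \<bullet> v < b $ i"
      using v by (simp add: polyhedron_of_iff order_less_le)
    have "((\<lambda>e. ?a i \<bullet> (v - e *\<^sub>R d)) \<longlongrightarrow> ?a i \<bullet> (v - 0 *\<^sub>R d)) (at_right 0)"
      by (intro tendsto_intros)
    then have "\<forall>\<^sub>F e in at_right 0. ?a i \<bullet> (v - e *\<^sub>R d) < b $ i"
      using less by (intro order_tendstoD(2)) auto
    then show ?thesis
      by (rule eventually_mono) simp
  qed
  have "\<forall>\<^sub>F e in at_right 0. (\<forall>i. ?a i \<bullet> (v - e *\<^sub>R d) \<le> b $ i) \<and> 0 < (e::real)"
    by (intro eventually_conj eventually_all_finite ev eventually_at_right_less)
  then obtain e where e: "\<And>i. ?a i \<bullet> (v - e *\<^sub>R d) \<le> b $ i" "0 < e"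
    using eventually_happens'[OF trivial_limit_at_right_real] by blast
  then have "z \<bullet> (v - e *\<^sub>R d) \<le> z \<bullet> v"
    by (intro max) (simp add: polyhedron_of_iff)
  then have "0 \<le> z \<bullet> d"
    using e(2) by (simp add: inner_diff_right zero_le_mult_iff)
  then show False
    using d(1) \<open>\<beta> < 0\<close> by (simp add: inner_commute)
qed

section \<open>Unimodularity\<close>

lemma det_in_Ints:
  fixes M :: "real ^ 'n ^ 'n"
  assumes "\<And>i j. M $ i $ j \<in> \<int>"
  shows "det M \<in> \<int>"
  unfolding det_def by (intro Ints_sum Ints_mult Ints_prod) (auto simp: assms)

lemma det_real_mat: "det (real_mat M) = real_of_int (det M)"
  unfolding det_def by simp

lemma minor_le_max_minor:
  fixes A :: "int ^ 'n ^ 'm" and f :: "'n \<Rightarrow> 'm"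
  assumes "inj f"
  shows "\<bar>det (\<chi> i. A $ f i)\<bar> \<le> max_minor A"
  unfolding max_minor_def
proof (rule Max_ge)
  show "finite {\<bar>det (\<chi> i. A $ f i)\<bar> | f :: 'n \<Rightarrow> 'm. inj f}"
    by (rule finite_image_set) simp
qed (use assms in blast)

text \<open>
  Cramer's rule: each coefficient is the quotient of the determinant of an integer matrix by
  \<open>det M\<close>.
\<close>

lemma unimodular_matrix_coefficients_integral:
  fixes M :: "int ^ 'n ^ 'n" and x :: "real ^ 'n"
  assumes "\<bar>det M\<bar> = 1"
    and "(\<Sum>i\<in>UNIV. x $ i *\<^sub>R row i (real_mat M)) \<in> int_vectors" (is "?z \<in> _")
  shows "x $ k \<in> \<int>"
proof -
  have "x $ k * det (real_mat M) = det (\<chi> i. if i = k then ?z else row i (real_mat M))"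
    using cramer_lemma_transpose[of k x "real_mat M"] unfolding scalar_mult_eq_scaleR by (rule sym)
  moreover have "det (\<chi> i. if i = k then ?z else row i (real_mat M)) \<in> \<int>"
    using assms(2) by (intro det_in_Ints) (auto simp: int_vectors_def row_def)
  ultimately have "x $ k * real_of_int (det M) \<in> \<int>"
    by (simp add: det_real_mat)
  moreover have "det M = 1 \<or> det M = -1"
    using assms(1) by linarith
  ultimately show ?thesis
    by auto
qed

text \<open>
  The independent rows extend to a basis consisting of rows of \<open>A\<close>.  The minor on these rows
  is a nonzero integer of absolute value at most 1, so the basis is unimodular.
\<close>

lemma unimodular_coefficients_integral:
  fixes A :: "int ^ 'n ^ 'm" and c :: "real ^ 'n \<Rightarrow> real"
  assumes rank: "rank (real_mat A) = CARD('n)" and minor: "max_minor A = 1"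
    and T: "T \<subseteq> rows (real_mat A)" "independent T"
    and z: "(\<Sum>a\<in>T. c a *\<^sub>R a) \<in> int_vectors"
    and "a \<in> T"
  shows "c a \<in> \<int>"
proof -
  obtain B where B: "T \<subseteq> B" "B \<subseteq> rows (real_mat A)" "independent B"
      "rows (real_mat A) \<subseteq> span B"
    using maximal_independent_subset_extend[OF T] .
  have "span B = span (rows (real_mat A))"
    using B(2,4) by (meson order_trans span_eq span_superset)
  then have "dim B = CARD('n)"
    using rank unfolding row_rank_def by (metis dim_span)
  then have "card B = CARD('n)"
    using B(3) by (simp add: dim_eq_card_independent)
  moreover have "finite B"
    using B(3) by (rule independent_imp_finite)
  ultimately obtain g :: "'n \<Rightarrow> real ^ 'n" where g: "bij_betw g UNIV B"
    using finite_same_card_bij[of "UNIV :: 'n set" B] by auto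
  have "\<exists>k. g i = row k (real_mat A)" for i
    using bij_betwE[OF g] B(2) unfolding rows_def by blast
  then obtain f where f: "\<And>i. g i = row (f i) (real_mat A)"
    by metis
  have "inj f"
    using g f unfolding bij_betw_def inj_on_def by metis
  define M where "M = (\<chi> i. A $ f i)"
  have rowM: "row i (real_mat M) = g i" for i
    unfolding f by (simp add: M_def row_def vec_eq_iff)
  have "rows (real_mat M) = B"
    using g unfolding rows_def rowM bij_betw_def by auto
  then have "rank (real_mat M) = CARD('n)"
    by (simp add: row_rank_def \<open>dim B = CARD('n)\<close>)
  then have "det M \<noteq> 0"
    using det_eq_0_rank[of "real_mat M"] by (auto simp: det_real_mat)
  moreover have "\<bar>det M\<bar> \<le> 1"
    using minor_le_max_minor[OF \<open>inj f\<close>, of A] minor unfolding M_def by simp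
  ultimately have "\<bar>det M\<bar> = 1"
    by linarith
  define x :: "real ^ 'n" where "x = (\<chi> i. if g i \<in> T then c (g i) else 0)"
  have "(\<Sum>i\<in>UNIV. x $ i *\<^sub>R row i (real_mat M)) = (\<Sum>i\<in>UNIV. (if g i \<in> T then c (g i) else 0) *\<^sub>R g i)"
    by (simp add: x_def rowM)
  also have "\<dots> = (\<Sum>a\<in>B. (if a \<in> T then c a else 0) *\<^sub>R a)"
    by (rule sum.reindex_bij_betw[OF g])
  also have "\<dots> = (\<Sum>a\<in>T. c a *\<^sub>R a)"
    using B(1) \<open>finite B\<close> by (intro sum.mono_neutral_cong_right) auto
  finally have "x $ k \<in> \<int>" for k
    using z \<open>\<bar>det M\<bar> = 1\<close> by (intro unimodular_matrix_coefficients_integral[of M]) auto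
  moreover obtain k where "g k = a"
    using g \<open>a \<in> T\<close> B(1) unfolding bij_betw_def by blast
  ultimately show ?thesis
    using \<open>a \<in> T\<close> unfolding x_def by (auto dest: meta_spec[of _ k])
qed

section \<open>Width\<close>

lemma width_along_ge:
  assumes "compact P" "x \<in> P" "y \<in> P"
  shows "z \<bullet> x - z \<bullet> y \<le> width_along P z"
proof -
  have "bounded ((\<bullet>) z ` P)"
    using assms(1) by (intro compact_imp_bounded compact_continuous_image continuous_intros)
  then have "z \<bullet> x \<le> (SUP x\<in>P. z \<bullet> x)" "(INF x\<in>P. z \<bullet> x) \<le> z \<bullet> y"
    using assms by (auto intro!: cSUP_upper cINF_lower bounded_imp_bdd_above bounded_imp_bdd_below)
  then show ?thesis
    unfolding width_along_def by simp
qed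

lemma width_along_le:
  assumes "P \<noteq> {}" "\<And>x y. x \<in> P \<Longrightarrow> y \<in> P \<Longrightarrow> z \<bullet> x - z \<bullet> y \<le> w"
  shows "width_along P z \<le> w"
proof -
  have "(SUP x\<in>P. z \<bullet> x) \<le> w + z \<bullet> y" if "y \<in> P" for y
    using assms that by (intro cSUP_least) (auto simp: algebra_simps)
  then have "(SUP x\<in>P. z \<bullet> x) - w \<le> (INF y\<in>P. z \<bullet> y)"
    using assms(1) by (intro cINF_greatest) (auto simp: algebra_simps)
  then show ?thesis
    unfolding width_along_def by simp
qed

lemma width_along_nonneg:
  assumes "compact P" "P \<noteq> {}"
  shows "0 \<le> width_along P z"
  using assms width_along_ge[of P] by fastforce

text \<open>
  The expansion of \<open>z\<close> in rows tight at a maximiser has nonnegative integer coefficients, one of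
  which is at least 1; the other rows contribute nonnegatively to the width.
\<close>

lemma exists_row_width_le:
  fixes A :: "int ^ 'n ^ 'm" and b :: "real ^ 'm"
  assumes rank: "rank (real_mat A) = CARD('n)" and minor: "max_minor A = 1"
    and P: "compact (polyhedron_of A b)" "polyhedron_of A b \<noteq> {}"
    and z: "z \<in> int_vectors" "z \<noteq> 0"
  shows "\<exists>a\<in>rows (real_mat A). width_along (polyhedron_of A b) a \<le> width_along (polyhedron_of A b) z"
proof -
  let ?P = "polyhedron_of A b"
  have "continuous_on ?P ((\<bullet>) z)"
    by (intro continuous_intros)
  then obtain v where v: "v \<in> ?P" "\<And>x. x \<in> ?P \<Longrightarrow> z \<bullet> x \<le> z \<bullet> v"
    using continuous_attains_sup[OF P] by blast
  define S where "S = {row i (real_mat A) | i. row i (real_mat A) \<bullet> v = b $ i}"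
  have "finite S"
    unfolding S_def by simp
  have S_max: "a \<bullet> x \<le> a \<bullet> v" if "a \<in> S" "x \<in> ?P" for a x
    using that by (auto simp: S_def polyhedron_of_iff)
  have "z \<in> convex_cone hull S"
    unfolding S_def using v by (rule maximizer_imp_in_tight_cone)
  then obtain c0 where c0: "\<And>x. x \<in> S \<Longrightarrow> 0 \<le> c0 x" "z = (\<Sum>x\<in>S. c0 x *\<^sub>R x)"
    using convex_cone_hull_finite_subset[OF \<open>finite S\<close>] by blast
  obtain T c where T: "T \<subseteq> S" "independent T" and c: "\<And>x. x \<in> T \<Longrightarrow> 0 \<le> c x"
    and sum_eq: "(\<Sum>x\<in>S. c0 x *\<^sub>R x) = (\<Sum>x\<in>T. c x *\<^sub>R x)"
    using conic_caratheodory[of S c0, OF \<open>finite S\<close> c0(1)] by blast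
  have zT: "z = (\<Sum>x\<in>T. c x *\<^sub>R x)"
    unfolding c0(2) by (rule sum_eq)
  have "S \<subseteq> rows (real_mat A)"
    unfolding S_def rows_def by blast
  then have c_int: "c x \<in> \<int>" if "x \<in> T" for x
    using unimodular_coefficients_integral[OF rank minor _ T(2)] T(1) z(1) zT that by blast
  have "\<exists>a\<in>T. c a \<noteq> 0"
  proof (rule ccontr)
    assume "\<not> (\<exists>a\<in>T. c a \<noteq> 0)"
    then have "z = 0"
      unfolding zT by (intro sum.neutral) auto
    with z(2) show False ..
  qed
  then obtain a where a: "a \<in> T" "c a \<noteq> 0"
    by blast
  have "1 \<le> c a"
    using c_int[OF a(1)] c[OF a(1)] a(2) by (auto elim!: Ints_cases)
  have "a \<bullet> x - a \<bullet> y \<le> width_along ?P z" if "x \<in> ?P" "y \<in> ?P" for x y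
  proof -
    have "a \<bullet> x - a \<bullet> y \<le> 1 * (a \<bullet> v - a \<bullet> y)"
      using S_max[of a x] T(1) a(1) that by auto
    also have "\<dots> \<le> c a * (a \<bullet> v - a \<bullet> y)"
      using S_max[of a y] T(1) a(1) that \<open>1 \<le> c a\<close> by (intro mult_right_mono) auto
    also have "\<dots> \<le> (\<Sum>a'\<in>T. c a' * (a' \<bullet> v - a' \<bullet> y))"
      using a(1) T(1) c S_max that finite_subset[OF T(1) \<open>finite S\<close>]
      by (intro member_le_sum) (auto intro!: mult_nonneg_nonneg)
    also have "\<dots> = z \<bullet> v - z \<bullet> y"
      unfolding zT by (simp add: inner_sum_left sum_subtractf right_diff_distrib)
    also have "\<dots> \<le> width_along ?P z"
      using P(1) v(1) that(2) by (rule width_along_ge)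
    finally show ?thesis .
  qed
  then have "width_along ?P a \<le> width_along ?P z"
    by (rule width_along_le[OF P(2)])
  then show ?thesis
    using a(1) T(1) \<open>S \<subseteq> rows (real_mat A)\<close> by blast
qed

theorem corollary1p10:
  fixes A :: "int ^ 'n ^ 'm" and b :: "real ^ 'm" and P :: "(real ^ 'n) set"
  defines "P \<equiv> polyhedron_of A b"
  assumes "CARD('m) \<ge> CARD('n)"
    and "rank (real_mat A) = CARD('n)"
    and "polytope P"
    and "\<And>i. {x \<in> P. row i (real_mat A) \<bullet> x = b $ i} facet_of P"
    and "max_minor A = 1"
  shows "lattice_width P = facet_width (rows (real_mat A)) P"
proof -
  let ?R = "rows (real_mat A)"
  note facet = assms(5)
  have "compact P"
    using assms(4) by (rule polytope_imp_compact)
  have "P \<noteq> {}"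
    using facet facet_of_empty by metis
  have R: "finite ?R" "?R \<noteq> {}"
    by (auto simp: rows_def full_SetCompr_eq)
  have row_nonzero: "row i (real_mat A) \<noteq> 0" for i
  proof
    assume zero: "row i (real_mat A) = 0"
    have "{x \<in> P. row i (real_mat A) \<bullet> x = b $ i} \<noteq> {}"
      using facet[of i] unfolding facet_of_def by blast
    then have "{x \<in> P. row i (real_mat A) \<bullet> x = b $ i} = P"
      using zero by auto
    then show False
      using facet[of i] facet_of_irrefl by metis
  qed
  have sub: "?R \<subseteq> int_vectors - {0}"
    using row_nonzero by (auto simp: rows_def int_vectors_def row_def)
  show ?thesis
  proof (rule antisym)
    have "facet_width ?R P \<in> width_along P ` ?R"
      unfolding facet_width_def using R by (intro Min_in) auto
    then obtain a where "a \<in> ?R" "facet_width ?R P = width_along P a"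
      by blast
    moreover have "bdd_below (width_along P ` (int_vectors - {0}))"
      using width_along_nonneg[OF \<open>compact P\<close> \<open>P \<noteq> {}\<close>] by (intro bdd_belowI[of _ 0]) auto
    ultimately show "lattice_width P \<le> facet_width ?R P"
      unfolding lattice_width_def using sub by (auto intro: cINF_lower)
  next
    show "facet_width ?R P \<le> lattice_width P"
      unfolding lattice_width_def
    proof (rule cINF_greatest)
      show "int_vectors - {0} \<noteq> ({} :: (real ^ 'n) set)"
        using sub R(2) by blast
    next
      fix z :: "real ^ 'n" assume "z \<in> int_vectors - {0}"
      then obtain a where "a \<in> ?R" "width_along P a \<le> width_along P z"
        using exists_row_width_le[OF assms(3,6)] \<open>compact P\<close> \<open>P \<noteq> {}\<close> unfolding P_def by blast
      moreover from this have "facet_width ?R P \<le> width_along P a"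
        unfolding facet_width_def using R by (intro Min_le) auto
      ultimately show "facet_width ?R P \<le> width_along P z"
        by linarith
    qed
  qed
qed

end
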